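(* For any integer $n>1$, there exist regular graphs $G$ with $\chi(G)=n$ and $\chi_2(G)>n$.
   Context: Graphs are finite and simple; a graph is regular if all its vertices have the same degree. $\chi(G)$ denotes the chromatic number of $G$. A dynamic $l$-coloring of $G$ is a proper vertex coloring of $G$ with colors in $\{1,\ldots,l\}$ such that for every vertex $v$ of degree at least $2$, at least two different colors appear on the neighbors of $v$. The dynamic chromatic number $\chi_2(G)$ is the smallest integer $l$ such that $G$ has a dynamic $l$-coloring. *)

theory Defs
  imports "Graph_Theory.Graph_Theory"
begin

text \<open>
  Finite simple graphs are rendered by the locale \<^locale>\<open>pair_graph\<close>: finite symmetric
  loop-free digraphs whose arcs are pairs of vertices. An edge \<open>{u, v}\<close> is the pair of arcs
  \<open>(u, v)\<close>, \<open>(v, u)\<close>, so the degree of a vertex is its \<^const>\<open>out_degree\<close> and the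
  set of its neighbors is the image \<open>parcs G `` {v}\<close>.
\<close>

definition regular_graph :: "'a pair_pre_digraph \<Rightarrow> bool" where
  "regular_graph G \<longleftrightarrow>
    (\<exists>d. \<forall>v \<in> pverts G. out_degree (with_proj G) v = d)"

definition proper_coloring :: "'a pair_pre_digraph \<Rightarrow> nat \<Rightarrow> ('a \<Rightarrow> nat) \<Rightarrow> bool" where
  "proper_coloring G l c \<longleftrightarrow>
    c ` pverts G \<subseteq> {1..l} \<and> (\<forall>(u, v) \<in> parcs G. c u \<noteq> c v)"

definition dynamic_coloring :: "'a pair_pre_digraph \<Rightarrow> nat \<Rightarrow> ('a \<Rightarrow> nat) \<Rightarrow> bool" where
  "dynamic_coloring G l c \<longleftrightarrow>
    proper_coloring G l c \<and>
    (\<forall>v \<in> pverts G. out_degree (with_proj G) v \<ge> 2 \<longrightarrow>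
      (\<exists>u \<in> parcs G `` {v}. \<exists>w \<in> parcs G `` {v}. c u \<noteq> c w))"

definition chromatic_number :: "'a pair_pre_digraph \<Rightarrow> nat" where
  "chromatic_number G = (LEAST l. \<exists>c. proper_coloring G l c)"

definition dynamic_chromatic_number :: "'a pair_pre_digraph \<Rightarrow> nat" where
  "dynamic_chromatic_number G = (LEAST l. \<exists>c. dynamic_coloring G l c)"

text \<open>Both minima range over a nonempty set when \<open>G\<close> is a finite simple graph.\<close>

lemma ex_dynamic_coloring:
  assumes "pair_graph G"
  shows "\<exists>l c. dynamic_coloring G l c"
proof -
  interpret pair_graph G by fact
  obtain f :: "'a \<Rightarrow> nat" where f: "bij_betw f (pverts G) {1..card (pverts G)}"
    using finite_same_card_bij[OF pair_finite_verts, of "{1..card (pverts G)}"] by auto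
  have inj: "f u \<noteq> f v" if "u \<in> pverts G" "v \<in> pverts G" "u \<noteq> v" for u v
    using f that by (auto simp: bij_betw_def inj_on_def)
  have "f u \<noteq> f v" if "(u, v) \<in> parcs G" for u v
    using inj[OF in_arcsD1[OF that] in_arcsD2[OF that]] pair_no_loops[OF that] by simp
  hence "proper_coloring G (card (pverts G)) f"
    using f by (auto simp: proper_coloring_def bij_betw_def)
  moreover have "\<exists>u \<in> parcs G `` {v}. \<exists>w \<in> parcs G `` {v}. f u \<noteq> f w"
    if "out_degree (with_proj G) v \<ge> 2" for v
  proof -
    have "out_arcs (with_proj G) v = Pair v ` (parcs G `` {v})"
      by (auto simp: out_arcs_def)
    hence "card (parcs G `` {v}) \<ge> 2"
      using that by (simp add: out_degree_def card_image inj_on_def)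
    then obtain u w where uw: "(v, u) \<in> parcs G" "(v, w) \<in> parcs G" "u \<noteq> w"
      using card_le_Suc0_iff_eq[of "parcs G `` {v}"] card.infinite[of "parcs G `` {v}"]
      by fastforce
    have "f u \<noteq> f w"
      using inj[OF in_arcsD2[OF uw(1)] in_arcsD2[OF uw(2)] uw(3)] .
    with uw show ?thesis by auto
  qed
  ultimately show ?thesis unfolding dynamic_coloring_def by blast
qed

lemma ex_proper_coloring:
  assumes "pair_graph G"
  shows "\<exists>l c. proper_coloring G l c"
  using ex_dynamic_coloring[OF assms] by (auto simp: dynamic_coloring_def)

end

theory Submission
  imports Defs
begin

text \<open>
  Put \<open>m = 3 n - 2\<close>. Arrange \<open>m\<close> blocks in a cycle, each a complete graph on \<open>n\<close> vertices
  \<open>(i, a)\<close>, \<open>a < n\<close>, and join \<open>(i, a)\<close> to \<open>(j, b)\<close> for cyclically consecutive \<open>i\<close>, \<open>j\<close> and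
  \<open>a \<noteq> b\<close>. Then add \<open>n\<close> further vertices \<open>(m, a)\<close>, the apexes, where \<open>(m, a)\<close> is joined
  exactly to the \<open>m\<close> vertices \<open>(i, a)\<close> with \<open>i < m\<close>. A block vertex has \<open>3 (n - 1)\<close>
  neighbors in the blocks and one apex as a neighbor, so the number \<open>m\<close> is chosen to make the
  graph \<open>m\<close>-regular.

  In a proper coloring with \<open>n\<close> colors each block carries all \<open>n\<close> colors. As \<open>(i + 1, a)\<close> is
  adjacent to every vertex of block \<open>i\<close> except \<open>(i, a)\<close>, it has the color of \<open>(i, a)\<close>.
  Hence all neighbors of the apex \<open>(m, a)\<close> have the same color (\<open>coloring_const\<close>), and the
  coloring is not dynamic. On the other hand, giving \<open>(i, a)\<close> color \<open>a + 1\<close> and the apex \<open>(m, a)\<close>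
  any other color is a proper coloring with \<open>n\<close> colors, and the blocks are cliques of
  size \<open>n\<close>, so that the chromatic number is \<open>n\<close>.
\<close>

text \<open>For \<open>i, j < m\<close>: equality or adjacency in the cycle \<open>0, 1, \<dots>, m - 1, 0\<close>.\<close>

definition cyc_near :: "nat \<Rightarrow> nat \<Rightarrow> nat \<Rightarrow> bool" where
  "cyc_near m i j \<longleftrightarrow> j = i \<or> j = (if Suc i = m then 0 else Suc i)
     \<or> i = (if Suc j = m then 0 else Suc j)"

text \<open>
  Adjacency of the vertices \<open>(i, a)\<close>, \<open>i \<le> m\<close>, \<open>a < n\<close>. The first coordinate \<open>m\<close> marks the
  apexes.
\<close>

definition cadj :: "nat \<Rightarrow> nat \<times> nat \<Rightarrow> nat \<times> nat \<Rightarrow> bool" where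
  "cadj m p q \<longleftrightarrow>
     fst p < m \<and> fst q < m \<and> cyc_near m (fst p) (fst q) \<and> snd p \<noteq> snd q \<or>
     (fst p < m \<and> fst q = m \<or> fst p = m \<and> fst q < m) \<and> snd p = snd q"

text \<open>The vertices: the blocks \<open>i < m\<close> together with the apexes \<open>i = m\<close>.\<close>

definition cverts :: "nat \<Rightarrow> nat \<Rightarrow> (nat \<times> nat) set" where
  "cverts n m = {..m} \<times> {..<n}"

text \<open>The graph itself, with the pairs encoded as natural numbers.\<close>

definition cgraph :: "nat \<Rightarrow> nat \<Rightarrow> nat pair_pre_digraph" where
  "cgraph n m = \<lparr> pverts = prod_encode ` cverts n m,
     parcs = {(prod_encode p, prod_encode q) | p q.
       p \<in> cverts n m \<and> q \<in> cverts n m \<and> cadj m p q} \<rparr>"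

lemma cadj_sym: "cadj m p q \<longleftrightarrow> cadj m q p"
proof -
  have "cyc_near m i j \<longleftrightarrow> cyc_near m j i" for i j
    unfolding cyc_near_def by blast
  thus ?thesis unfolding cadj_def by metis
qed

lemma parcs_cgraph_iff:
  "(prod_encode p, prod_encode q) \<in> parcs (cgraph n m) \<longleftrightarrow>
     p \<in> cverts n m \<and> q \<in> cverts n m \<and> cadj m p q"
  by (cases p; cases q) (auto simp: cgraph_def)

lemma pair_graph_cgraph: "pair_graph (cgraph n m)"
proof
  show "finite (pverts (cgraph n m))"
    by (auto simp: cgraph_def cverts_def)
  show "finite (parcs (cgraph n m))"
    by (rule finite_subset[of _ "prod_encode ` cverts n m \<times> prod_encode ` cverts n m"])
       (auto simp: cgraph_def cverts_def)
  have "sym (parcs (cgraph n m))"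
    by (rule symI) (auto simp: cgraph_def cadj_sym)
  thus "symmetric (with_proj (cgraph n m))"
    by (simp add: symmetric_def)
qed (auto simp: cgraph_def cadj_def)

lemma out_degree_pair: "out_degree (with_proj G) v = card (parcs G `` {v})"
proof -
  have "out_arcs (with_proj G) v = Pair v ` (parcs G `` {v})"
    by (auto simp: out_arcs_def)
  thus ?thesis by (simp add: out_degree_def card_image inj_on_def)
qed

lemma nbrs_cgraph:
  assumes "p \<in> cverts n m"
  shows "parcs (cgraph n m) `` {prod_encode p} = prod_encode ` {q \<in> cverts n m. cadj m p q}"
  using assms by (cases p) (auto simp: cgraph_def)

lemma card_cyc_near:
  assumes "i < m" "m \<ge> 3"
  shows "card {j. j < m \<and> cyc_near m i j} = 3"
proof -
  have "{j. j < m \<and> cyc_near m i j} =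
     {i, if Suc i = m then 0 else Suc i, if i = 0 then m - 1 else i - 1}"
    using assms by (auto simp: cyc_near_def split: if_splits)
  also have "card \<dots> = 3" using assms by auto
  finally show ?thesis .
qed

lemma out_degree_apex:
  assumes "a < n"
  shows "out_degree (with_proj (cgraph n m)) (prod_encode (m, a)) = m"
proof -
  have "{q \<in> cverts n m. cadj m (m, a) q} = {..<m} \<times> {a}"
    using assms by (auto simp: cverts_def cadj_def)
  thus ?thesis using assms
    by (simp add: out_degree_pair nbrs_cgraph cverts_def card_image inj_prod_encode)
qed

lemma out_degree_block:
  assumes "i < m" "a < n" "m \<ge> 3"
  shows "out_degree (with_proj (cgraph n m)) (prod_encode (i, a)) = 3 * (n - 1) + 1"
proof -
  have eq: "{q \<in> cverts n m. cadj m (i, a) q} =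
      insert (m, a) ({j. j < m \<and> cyc_near m i j} \<times> ({..<n} - {a}))"
    using assms by (auto simp: cverts_def cadj_def)
  have "card {q \<in> cverts n m. cadj m (i, a) q} = 3 * (n - 1) + 1"
    unfolding eq using assms by (subst card_insert_disjoint)
      (auto simp: card_cartesian_product card_cyc_near)
  thus ?thesis using assms
    by (simp add: out_degree_pair nbrs_cgraph cverts_def card_image inj_prod_encode)
qed

lemma regular_cgraph:
  assumes "n > 1"
  shows "regular_graph (cgraph n (3 * n - 2))"
  unfolding regular_graph_def
proof (intro exI ballI)
  fix v assume "v \<in> pverts (cgraph n (3 * n - 2))"
  then obtain i a where v: "v = prod_encode (i, a)" "i \<le> 3 * n - 2" "a < n"
    by (auto simp: cgraph_def cverts_def)
  show "out_degree (with_proj (cgraph n (3 * n - 2))) v = 3 * n - 2"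
  proof (cases "i = 3 * n - 2")
    case True
    then show ?thesis using v out_degree_apex by simp
  next
    case False
    then show ?thesis using v assms out_degree_block[of i "3 * n - 2" a n] by simp
  qed
qed

lemma ex_coloring_cgraph:
  assumes "n > 1"
  shows "\<exists>c. proper_coloring (cgraph n m) n c"
proof
  define c where "c = (\<lambda>(i, a). if i = m then (if a = 0 then 2 else 1) else Suc a)"
  show "proper_coloring (cgraph n m) n (c \<circ> prod_decode)"
    using assms
    by (auto simp: proper_coloring_def cgraph_def cverts_def cadj_def c_def split: if_splits)
qed

lemma coloring_neq:
  assumes "proper_coloring (cgraph n m) l c"
    and "i < m" "j < m" "j = i \<or> j = Suc i" "a < n" "b < n" "a \<noteq> b"
  shows "c (prod_encode (i, a)) \<noteq> c (prod_encode (j, b))"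
proof -
  have "(prod_encode (i, a), prod_encode (j, b)) \<in> parcs (cgraph n m)"
    using assms by (auto simp: parcs_cgraph_iff cverts_def cadj_def cyc_near_def)
  thus ?thesis using assms(1) unfolding proper_coloring_def by blast
qed

lemma coloring_in:
  assumes "proper_coloring (cgraph n m) l c" "i \<le> m" "a < n"
  shows "c (prod_encode (i, a)) \<in> {1..l}"
proof -
  have "prod_encode (i, a) \<in> pverts (cgraph n m)"
    using assms by (auto simp: cgraph_def cverts_def)
  thus ?thesis using assms(1) unfolding proper_coloring_def by blast
qed

lemma block_inj:
  assumes "proper_coloring (cgraph n m) l c" "i < m"
  shows "inj_on (\<lambda>a. c (prod_encode (i, a))) {..<n}"
proof (rule inj_onI)
  fix a b assume "a \<in> {..<n}" "b \<in> {..<n}" "c (prod_encode (i, a)) = c (prod_encode (i, b))"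
  thus "a = b" using coloring_neq[OF assms(1,2,2), of a b] by auto
qed

lemma coloring_ge:
  assumes "proper_coloring (cgraph n m) l c" "m > 0"
  shows "n \<le> l"
proof -
  have "(\<lambda>a. c (prod_encode (0, a))) ` {..<n} \<subseteq> {1..l}"
    using coloring_in[OF assms(1), of 0] by blast
  from card_inj_on_le[OF block_inj[OF assms] this] show ?thesis by simp
qed

lemma coloring_step:
  assumes c: "proper_coloring (cgraph n m) n c" and "Suc i < m" "a < n"
  shows "c (prod_encode (Suc i, a)) = c (prod_encode (i, a))"
proof -
  have sub: "(\<lambda>b. c (prod_encode (i, b))) ` {..<n} \<subseteq> {1..n}"
    using coloring_in[OF c, of i] assms(2) by (intro image_subsetI) simp
  \<comment> \<open>Block \<open>i\<close> uses all the colors, in particular that of \<open>(i + 1, a)\<close>.\<close>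
  have "(\<lambda>b. c (prod_encode (i, b))) ` {..<n} = {1..n}"
    by (rule card_subset_eq[OF _ sub]) (use block_inj[OF c, of i] assms(2) in \<open>simp_all add: card_image\<close>)
  moreover have "c (prod_encode (Suc i, a)) \<in> {1..n}"
    using coloring_in[OF c, of "Suc i" a] assms by simp
  ultimately have "c (prod_encode (Suc i, a)) \<in> (\<lambda>b. c (prod_encode (i, b))) ` {..<n}"
    by (simp only:)
  then obtain b where b: "b < n" "c (prod_encode (Suc i, a)) = c (prod_encode (i, b))"
    by blast
  have "b = a"
    using coloring_neq[OF c, of i "Suc i" b a] b assms by linarith
  with b show ?thesis by simp
qed

lemma coloring_const:
  assumes c: "proper_coloring (cgraph n m) n c" and "i < m" "a < n"
  shows "c (prod_encode (i, a)) = c (prod_encode (0, a))"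
  using assms(2) by (induction i) (auto simp: coloring_step[OF c _ assms(3)])

lemma not_dynamic_cgraph:
  assumes "n > 0" "m \<ge> 2"
  shows "\<not> dynamic_coloring (cgraph n m) n c"
proof
  assume dyn: "dynamic_coloring (cgraph n m) n c"
  hence c: "proper_coloring (cgraph n m) n c" by (simp add: dynamic_coloring_def)
  have apex: "(m, 0) \<in> cverts n m" using assms by (simp add: cverts_def)
  hence "prod_encode (m, 0) \<in> pverts (cgraph n m)" by (simp add: cgraph_def)
  then obtain u w where uw: "u \<in> parcs (cgraph n m) `` {prod_encode (m, 0)}"
      "w \<in> parcs (cgraph n m) `` {prod_encode (m, 0)}" "c u \<noteq> c w"
    using dyn out_degree_apex[OF assms(1), of m] assms(2) unfolding dynamic_coloring_def by metis
  have "c x = c (prod_encode (0, 0))" if x: "x \<in> parcs (cgraph n m) `` {prod_encode (m, 0)}" for x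
  proof -
    obtain i where "i < m" "x = prod_encode (i, 0)"
      using x unfolding nbrs_cgraph[OF apex] by (auto simp: cadj_def)
    thus ?thesis using coloring_const[OF c _ assms(1)] by blast
  qed
  with uw show False by metis
qed

theorem proposition1:
  fixes n :: nat
  assumes "n > 1"
  shows "\<exists>G :: nat pair_pre_digraph. pair_graph G \<and> regular_graph G \<and>
    chromatic_number G = n \<and> dynamic_chromatic_number G > n"
proof -
  define m where "m = 3 * n - 2"
  let ?G = "cgraph n m"
  have m: "m \<ge> 2" using assms by (simp add: m_def)
  have ge: "n \<le> l" if "proper_coloring ?G l c" for l c
    using coloring_ge[OF that] m by simp
  have "chromatic_number ?G = n"
    unfolding chromatic_number_def
    by (rule Least_equality) (use ex_coloring_cgraph[OF assms] ge in auto)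
  moreover have "dynamic_chromatic_number ?G > n"
  proof -
    let ?l = "dynamic_chromatic_number ?G"
    obtain c where c: "dynamic_coloring ?G ?l c"
      using LeastI_ex[OF ex_dynamic_coloring[OF pair_graph_cgraph]]
      unfolding dynamic_chromatic_number_def by blast
    hence "n \<le> ?l" using ge by (auto simp: dynamic_coloring_def)
    moreover have "?l \<noteq> n" using c not_dynamic_cgraph[of n m c] assms m by auto
    ultimately show ?thesis by simp
  qed
  ultimately show ?thesis
    using pair_graph_cgraph regular_cgraph[OF assms] unfolding m_def by blast
qed

end
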